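(* For every positive integer $d$ there exists a positive constant $c=c(d)$, depending only on $d$, such that for all sufficiently large integers $n$ (how large may depend on $d$), $$\mathcal{Z}_{n,d}\leq 2^{c\,n^{d/2}},$$ where $\mathcal{Z}_{n,d}$ is the number of all Sidon sets contained in $[n]^d$.
   Context: For positive integers $d,n$, $[n]^d$ denotes the set of all vectors $(a_1,\dots,a_d)$ of integers with $0\le a_i\le n-1$. A subset $S\subseteq[n]^d$ is a Sidon set if all sums of two (not necessarily distinct) vectors of $S$ are distinct, i.e. whenever $a+b=c+e$ with $a,b,c,e\in S$ one has $\{a,b\}=\{c,e\}$. $\mathcal{Z}_{n,d}$ denotes the number of Sidon sets $S\subseteq[n]^d$. *)

theory Defs
  imports Complex_Main "Jordan_Normal_Form.Matrix"
begin

definition grid :: "nat \<Rightarrow> nat \<Rightarrow> int vec set" where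
  "grid n d = {a \<in> carrier_vec d. \<forall>i<d. 0 \<le> a $ i \<and> a $ i \<le> int n - 1}"

definition sidon :: "'a::plus set \<Rightarrow> bool" where
  "sidon S \<longleftrightarrow> (\<forall>a\<in>S. \<forall>b\<in>S. \<forall>c\<in>S. \<forall>e\<in>S. a + b = c + e \<longrightarrow> {a, b} = {c, e})"

definition sidon_count :: "nat \<Rightarrow> nat \<Rightarrow> nat" where
  "sidon_count n d = card {S. S \<subseteq> grid n d \<and> sidon S}"

text \<open>The cardinality above is that of a finite set, so it is a genuine count.\<close>

lemma finite_grid: "finite (grid n d)"
proof (rule finite_subset)
  show "grid n d \<subseteq> vec_of_list ` {xs. set xs \<subseteq> {0..int n - 1} \<and> length xs = d}"
  proof
    fix a assume a: "a \<in> grid n d"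
    have "a = vec_of_list (list_of_vec a)" by (simp add: vec_list)
    moreover have "set (list_of_vec a) \<subseteq> {0..int n - 1}" "length (list_of_vec a) = d"
      using a by (auto simp: grid_def in_set_conv_nth list_of_vec_index)
    ultimately show "a \<in> vec_of_list ` {xs. set xs \<subseteq> {0..int n - 1} \<and> length xs = d}"
      by blast
  qed
qed (simp add: finite_lists_length_eq)

lemma finite_sidon_sets: "finite {S. S \<subseteq> grid n d \<and> sidon S}"
  by (rule finite_subset[of _ "Pow (grid n d)"]) (auto simp: finite_grid)

end

theory Submission
  imports Defs "HOL-Analysis.Convex" "HOL-Library.Function_Algebras" "HOL-Real_Asymp.Real_Asymp"
begin

text \<open>Let \<open>V\<close> be a finite subset of an abelian group whose sumset \<open>V + V\<close> has at most \<open>T\<close> elements. The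
heart of the matter is that \<open>V\<close> has at most \<open>exp (37 * sqrt T)\<close> Sidon subsets once \<open>T\<close> is large
(\<open>eventually_card_sidon_subsets_le\<close>). For the grid one may take \<open>T = (2n)^d\<close>, and \<open>sqrt T\<close> is a
constant depending on \<open>d\<close> times \<open>n powr (d/2)\<close>.

A Sidon subset of \<open>V\<close> has \<open>O(sqrt T)\<close> elements, so listing its elements one by one only gives
\<open>exp (O(sqrt T * ln T))\<close>. The logarithm is removed by an argument in the style of Kleitman and
Winston. Suppose that \<open>S\<close> with \<open>card S = s\<close> has been chosen already and that \<open>U\<close> is a set of \<open>u\<close>
candidates for further elements. Two candidates \<open>x \<noteq> y\<close> are in conflict if \<open>x + a = y + b\<close> for some
\<open>a, b \<in> S\<close>; then no Sidon set contains \<open>S\<close>, \<open>x\<close> and \<open>y\<close> together. There are \<open>s * u\<close> sums \<open>x + a\<close>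
and at most \<open>T\<close> possible values, so for \<open>s * u \<ge> 2 * T\<close> the Cauchy-Schwarz inequality forces many
coincidences, and since \<open>S\<close> is Sidon distinct coincidences come from distinct pairs \<open>(x, y)\<close>.
Hence some candidate \<open>v\<close> is in conflict with at least \<open>s\<^sup>2 / (2 * T) * u\<close> others (\<open>many_conflicts\<close>).

Branch on whether the Sidon set contains \<open>v\<close>. If not, \<open>U\<close> loses one candidate; if so, \<open>s\<close> grows
by one and \<open>U\<close> shrinks by at least the factor \<open>1 - s\<^sup>2 / (2 * T)\<close> as long as \<open>u \<ge> 2 * T / s\<close>. So, up to few
exceptional choices, the next element is picked from about \<open>T / s\<close> candidates. With the order of
the elements divided out, \<open>s\<close> elements can be chosen in about \<open>(C * T) ^ s / (fact s)\<^sup>2\<close> ways, and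
this is at most \<open>exp (2 * sqrt (C * T))\<close> for every \<open>s\<close> because \<open>x ^ s / fact s \<le> exp x\<close>. An
explicit function \<open>potential T s u\<close> turns this heuristic into an induction on \<open>u\<close>
(\<open>potential_step\<close>, \<open>card_extensions_le\<close>).

The induction works only for \<open>s\<close> well above \<open>T powr (1/3)\<close>, where the conflicts have an effect. It is
started at \<open>s = \<lceil>T powr (2/5)\<rceil>\<close>; the first \<open>s\<close> elements are chosen arbitrarily, which costs a factor
\<open>exp (O(T powr (2/5) * ln T))\<close>, negligible against \<open>exp (sqrt T)\<close>.\<close>

section \<open>Conflicts between candidates\<close>

text \<open>Cauchy-Schwarz, applied to the sizes of the fibres of \<open>f\<close>: their sum is \<open>card P\<close> and the sum of
their squares counts the pairs that \<open>f\<close> identifies.\<close>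

lemma fibre_collision_bound:
  assumes P: "finite P"
  shows "(card P)\<^sup>2 \<le> card (f ` P) * card (SIGMA p:P. {q \<in> P. f q = f p})"
proof -
  define r where "r z = card {q \<in> P. f q = z}" for z
  have total: "card P = (\<Sum>z\<in>f ` P. r z)"
    using sum.image_gen[OF P, of "\<lambda>_. 1::nat" f] by (simp add: r_def)
  have "card (SIGMA p:P. {q \<in> P. f q = f p}) = (\<Sum>p\<in>P. r (f p))"
    using P by (simp add: r_def)
  also have "\<dots> = (\<Sum>z\<in>f ` P. \<Sum>p\<in>{p \<in> P. f p = z}. r (f p))"
    by (rule sum.image_gen[OF P])
  also have "\<dots> = (\<Sum>z\<in>f ` P. (r z)\<^sup>2)"
    by (intro sum.cong refl) (simp add: r_def power2_eq_square)
  finally have coll: "card (SIGMA p:P. {q \<in> P. f q = f p}) = (\<Sum>z\<in>f ` P. (r z)\<^sup>2)" .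
  have "(\<Sum>z\<in>f ` P. real (r z))\<^sup>2 \<le> (\<Sum>z\<in>f ` P. (real (r z))\<^sup>2) * card (f ` P)"
    by (rule sum_squared_le_sum_of_squares)
  then have "real ((card P)\<^sup>2) \<le> real (card (f ` P) * card (SIGMA p:P. {q \<in> P. f q = f p}))"
    unfolding total coll by (simp add: mult.commute)
  then show ?thesis by (simp only: of_nat_le_iff)
qed

definition conflicts :: "'a::ab_group_add set \<Rightarrow> 'a \<Rightarrow> 'a set" where
  "conflicts S x = {y. y \<noteq> x \<and> (\<exists>a\<in>S. \<exists>b\<in>S. x + a = y + b)}"

lemma sidonD:
  "sidon S \<Longrightarrow> a \<in> S \<Longrightarrow> b \<in> S \<Longrightarrow> c \<in> S \<Longrightarrow> e \<in> S \<Longrightarrow> a + b = c + e \<Longrightarrow> {a, b} = {c, e}"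
  unfolding sidon_def by blast

lemma sidon_subset: "sidon S \<Longrightarrow> S' \<subseteq> S \<Longrightarrow> sidon S'"
  unfolding sidon_def by blast

text \<open>From \<open>x + a = y + b\<close> with all four in a Sidon set it follows that \<open>x = b\<close>, as \<open>x \<noteq> y\<close>; but \<open>b\<close>
lies in \<open>S\<close> and \<open>x\<close> does not.\<close>

lemma sidon_excludes_conflicts:
  assumes "sidon W" "S \<subseteq> W" "x \<in> W - S" "y \<in> W - S"
  shows "y \<notin> conflicts S x"
proof
  assume "y \<in> conflicts S x"
  then obtain a b where ab: "y \<noteq> x" "a \<in> S" "b \<in> S" "x + a = y + b"
    unfolding conflicts_def by blast
  then have "{x, a} = {y, b}"
    using assms by (intro sidonD[OF assms(1)]) auto
  then show False using ab assms by (auto simp: doubleton_eq_iff)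
qed

text \<open>The collisions \<open>x + a = y + b\<close> with \<open>x = y\<close> are trivial and contribute \<open>card U * card S\<close>. Every other
collision is determined by \<open>(x, y)\<close>: it gives \<open>a - b = y - x \<noteq> 0\<close>, and a nonzero difference has at
most one representation in a Sidon set. The sum counts the pairs \<open>(x, y)\<close> in conflict.\<close>

lemma sidon_collisions_le:
  fixes U S :: "'a::ab_group_add set"
  assumes "finite U" "finite S" and S: "sidon S"
  shows "card (SIGMA p:U \<times> S. {q \<in> U \<times> S. fst q + snd q = fst p + snd p})
    \<le> card U * card S + (\<Sum>x\<in>U. card (U \<inter> conflicts S x))"
proof -
  define Q where "Q = (SIGMA p:U \<times> S. {q \<in> U \<times> S. fst q + snd q = fst p + snd p})"
  define ends :: "('a \<times> 'a) \<times> 'a \<times> 'a \<Rightarrow> 'a \<times> 'a" where "ends = (\<lambda>(p, q). (fst p, fst q))"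
  define D where "D = {(p, q) \<in> Q. fst p = fst q}"
  have "D \<subseteq> (\<lambda>p. (p, p)) ` (U \<times> S)"
    by (auto simp: D_def Q_def image_def)
  then have "card D \<le> card U * card S"
    by (metis assms(1,2) card_cartesian_product finite_SigmaI surj_card_le)
  moreover have "card (Q - D) \<le> card (SIGMA x:U. U \<inter> conflicts S x)"
  proof (rule card_inj_on_le)
    show "inj_on ends (Q - D)"
    proof (rule inj_onI)
      fix t t' assume t: "t \<in> Q - D" "t' \<in> Q - D" "ends t = ends t'"
      obtain x a y b where e: "t = ((x, a), (y, b))" by (metis surj_pair)
      obtain a' b' where e': "t' = ((x, a'), (y, b'))"
        using t(3) e by (cases t') (auto simp: ends_def)
      have mem: "a \<in> S" "b \<in> S" "a' \<in> S" "b' \<in> S" "x \<noteq> y" "x + a = y + b" "x + a' = y + b'"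
        using t e e' by (auto simp: Q_def D_def)
      have "a + b' = a' + b"
      proof -
        have "(x + a) + (y + b') = (y + b) + (x + a')" using mem by simp
        then show ?thesis by (simp add: algebra_simps)
      qed
      then have "{a, b'} = {a', b}" by (intro sidonD[OF S]) (use mem in auto)
      then show "t = t'" using mem e e' by (auto simp: doubleton_eq_iff)
    qed
    show "ends ` (Q - D) \<subseteq> (SIGMA x:U. U \<inter> conflicts S x)"
      by (auto simp: ends_def Q_def D_def conflicts_def) metis+
    show "finite (SIGMA x:U. U \<inter> conflicts S x)" using assms by simp
  qed
  moreover have "card (SIGMA x:U. U \<inter> conflicts S x) = (\<Sum>x\<in>U. card (U \<inter> conflicts S x))"
    using assms by simp
  moreover have "card Q \<le> card D + card (Q - D)"
    using card_Un_le[of D "Q - D"] by (simp add: D_def Un_absorb1 subset_iff)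
  ultimately show ?thesis unfolding Q_def by linarith
qed

text \<open>With \<open>m = card S * card U\<close>, at least \<open>m\<^sup>2 / T\<close> collisions exist and only \<open>m \<le> m\<^sup>2 / (2 * T)\<close> of them
are trivial; averaging the others over \<open>U\<close> gives the element \<open>x\<close>.\<close>

lemma many_conflicts:
  fixes U S :: "'a::ab_group_add set" and T :: real
  assumes fin: "finite U" "finite S" and S: "sidon S" and "T > 0"
    and sums: "real (card ((\<lambda>p. fst p + snd p) ` (U \<times> S))) \<le> T"
    and large: "real (card S) * real (card U) \<ge> 2 * T"
  shows "\<exists>x\<in>U. real (card (U \<inter> conflicts S x)) \<ge> (real (card S))\<^sup>2 / (2 * T) * real (card U)"
proof (rule ccontr)
  assume "\<not> ?thesis"
  then have few: "real (card (U \<inter> conflicts S x)) < (real (card S))\<^sup>2 / (2 * T) * real (card U)"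
    if "x \<in> U" for x using that by force
  define m where "m = real (card S) * real (card U)"
  define e where "e = (\<Sum>x\<in>U. real (card (U \<inter> conflicts S x)))"
  have m: "m \<ge> 2 * T" "m > 0" using large \<open>T > 0\<close> by (auto simp: m_def)
  have "U \<noteq> {}" using m by (auto simp: m_def)
  then have "e < (\<Sum>x\<in>U. (real (card S))\<^sup>2 / (2 * T) * real (card U))"
    unfolding e_def using fin few by (intro sum_strict_mono) auto
  also have "\<dots> = m\<^sup>2 / (2 * T)"
    by (simp add: m_def power_mult_distrib power2_eq_square)
  finally have e: "e < m\<^sup>2 / (2 * T)" .
  define C where "C = card (SIGMA p:U \<times> S. {q \<in> U \<times> S. fst q + snd q = fst p + snd p})"
  have "C \<le> card U * card S + (\<Sum>x\<in>U. card (U \<inter> conflicts S x))"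
    unfolding C_def by (rule sidon_collisions_le[OF fin S])
  then have "real C \<le> real (card U * card S + (\<Sum>x\<in>U. card (U \<inter> conflicts S x)))"
    by (simp only: of_nat_le_iff)
  then have C: "real C \<le> m + e" by (simp add: m_def e_def mult.commute)
  have "real ((card (U \<times> S))\<^sup>2) \<le> real (card ((\<lambda>p. fst p + snd p) ` (U \<times> S)) * C)"
    unfolding C_def of_nat_le_iff using fin by (intro fibre_collision_bound) auto
  then have "m\<^sup>2 \<le> real (card ((\<lambda>p. fst p + snd p) ` (U \<times> S))) * real C"
    by (simp add: m_def card_cartesian_product mult.commute)
  also have "\<dots> \<le> T * (m + e)"
    using sums C \<open>T > 0\<close> by (intro mult_mono) auto
  also have "\<dots> < T * (m + m\<^sup>2 / (2 * T))"
    using e \<open>T > 0\<close> by simp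
  also have "\<dots> = T * m + m\<^sup>2 / 2"
    using \<open>T > 0\<close> by (simp add: field_simps)
  also have "\<dots> \<le> m\<^sup>2"
  proof -
    have "2 * T * m \<le> m * m" using m by (intro mult_right_mono) auto
    then show ?thesis by (simp add: power2_eq_square)
  qed
  finally show False by simp
qed

section \<open>The potential function\<close>

text \<open>An upper bound for the number of ways to extend a set of \<open>s\<close> elements by some of \<open>u\<close> candidates.
The last factor behaves like \<open>exp (s\<^sup>2 * u / T)\<close> for \<open>u\<close> below the critical size \<open>T / s\<close> and like
\<open>(s * u / T) ^ s\<close> above it; the latter allows for about \<open>s\<close> exceptional choices made before the
conflicts have cut \<open>U\<close> down to the critical size. The quotient \<open>(s + 1)\<^sup>2 / (324 * T)\<close> of consecutive
coefficients is, up to a constant, the relative growth of the potential per candidate near the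
critical size: that growth has to pay for the branch in which the next element is chosen. The
factor \<open>exp (2 * sqrt (324 * T))\<close> makes the potential at least 1 for all \<open>s\<close>.\<close>

definition potential :: "real \<Rightarrow> nat \<Rightarrow> nat \<Rightarrow> real" where
  "potential T s u =
    exp (2 * sqrt (324 * T)) * (fact s)\<^sup>2 / (324 * T) ^ s * (1 + real s * real u / T) ^ s"

lemma power_le_fact_exp:
  fixes x :: real
  assumes "x \<ge> 0"
  shows "x ^ s \<le> fact s * exp x"
proof -
  have "(\<Sum>n\<in>{s}. x ^ n /\<^sub>R fact n) \<le> (\<Sum>n. x ^ n /\<^sub>R fact n)"
    using assms by (intro sum_le_suminf summable_exp_generic) auto
  then have "x ^ s /\<^sub>R fact s \<le> exp x" by (simp add: exp_def)
  then show ?thesis by (simp add: field_simps)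
qed

lemma potential_ge_1:
  assumes "T > 0"
  shows "1 \<le> potential T s u"
proof -
  define x where "x = sqrt (324 * T)"
  have x: "x \<ge> 0" "x\<^sup>2 = 324 * T" using assms by (auto simp: x_def)
  have "(324 * T) ^ s = (x\<^sup>2) ^ s" using x by simp
  also have "\<dots> = (x ^ s)\<^sup>2" by (simp only: power_mult[symmetric] mult.commute)
  also have "\<dots> \<le> (fact s * exp x)\<^sup>2"
    using x by (intro power_mono power_le_fact_exp) auto
  also have "\<dots> = exp (2 * x) * (fact s)\<^sup>2"
    unfolding power_mult_distrib exp_double by (rule mult.commute)
  finally have "1 \<le> exp (2 * x) * (fact s)\<^sup>2 / (324 * T) ^ s"
    using assms by (simp add: field_simps)
  moreover have "1 \<le> (1 + real s * real u / T) ^ s"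
    using assms by (intro one_le_power) auto
  ultimately show ?thesis
    unfolding potential_def x_def[symmetric] by (metis mult_mono' mult_1 zero_le_one)
qed

lemma power_Suc_add_ge:
  fixes y h :: real
  assumes "y \<ge> 0" "h \<ge> 0"
  shows "y ^ Suc k + real (Suc k) * h * y ^ k \<le> (y + h) ^ Suc k"
proof (induction k)
  case (Suc k)
  have "y ^ Suc (Suc k) + real (Suc (Suc k)) * h * y ^ Suc k
      \<le> (y + h) * (y ^ Suc k + real (Suc k) * h * y ^ k)"
    using assms by (simp add: algebra_simps)
  also have "\<dots> \<le> (y + h) * (y + h) ^ Suc k"
    using assms Suc by (intro mult_left_mono) auto
  finally show ?case by simp
qed simp

lemma one_plus_inverse_power_le:
  assumes "s \<ge> 1"
  shows "(1 + 1 / real s) ^ Suc s \<le> 9"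
proof -
  have "(1 + 1 / real s) ^ Suc s \<le> exp (1 / real s) ^ Suc s"
    by (intro power_mono exp_ge_add_one_self) auto
  also have "\<dots> = exp (real (Suc s) * (1 / real s))" by (simp only: exp_of_nat_mult)
  also have "\<dots> \<le> exp (1 + 1)" using assms by (simp add: field_simps)
  also have "\<dots> = (exp 1)\<^sup>2" by (simp only: exp_add power2_eq_square)
  also have "\<dots> \<le> 3\<^sup>2" by (intro power_mono exp_le) auto
  finally show ?thesis by simp
qed

text \<open>The left-hand side has two factors more than the right-hand side. If \<open>s * (u + 1) < 2 * T\<close>,
each of them is at most 3. Otherwise the removal of conflicting candidates multiplies the base by
at most \<open>exp (- (s\<^sup>2 / (4 * T)))\<close>. In the power \<open>s + 1\<close> this saves \<open>exp (s ^ 3 / (4 * T))\<close>, which by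
the assumption on \<open>s\<close> outweighs the two surplus factors, as they are at most \<open>1 + s\<close> each.\<close>

lemma power_candidates_le:
  assumes T: "T > 0" and s: "s \<ge> 1" "(1 + real s)\<^sup>2 \<le> exp (real s ^ 3 / (4 * T))"
    and u: "real u \<le> T" and w: "w \<le> u"
    and drop: "real s * real (Suc u) \<ge> 2 * T
      \<Longrightarrow> real w \<le> real u - (real s)\<^sup>2 / (2 * T) * real (Suc u)"
  shows "(1 + real s * real w / T) ^ Suc s \<le> 9 * (1 + real s * real u / T) ^ (s - 1)"
proof -
  define y where "y = 1 + real s * real u / T"
  have y1: "y \<ge> 1" using T by (simp add: y_def)
  have split: "y ^ Suc s = y\<^sup>2 * y ^ (s - 1)"
    using s(1) by (metis Suc_diff_1 Suc_le_eq One_nat_def mult.assoc power2_eq_square power_Suc)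
  show ?thesis
  proof (cases "real s * real (Suc u) \<ge> 2 * T")
    case False
    have "real s * real u \<le> real s * real (Suc u)" by (intro mult_left_mono) auto
    then have "y \<le> 3" using False T by (simp add: y_def divide_simps)
    then have y9: "y\<^sup>2 \<le> 9" using power_mono[of y 3 2] y1 by simp
    have "(1 + real s * real w / T) ^ Suc s \<le> y ^ Suc s"
      unfolding y_def using T w
      by (intro power_mono add_mono divide_right_mono mult_left_mono) auto
    also have "\<dots> \<le> 9 * y ^ (s - 1)"
      unfolding split using y9 y1 by (intro mult_right_mono) auto
    finally show ?thesis by (simp add: y_def)
  next
    case True
    \<comment> \<open>One conflict step shrinks the candidates by the proportion \<open>\<beta>\<close>; \<open>a\<close> is at least half of the base \<open>y\<close>.\<close>
    define \<beta> where "\<beta> = (real s)\<^sup>2 / (2 * T)"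
    define a where "a = real s * real (Suc u) / T"
    have "\<beta> \<ge> 0" using T by (simp add: \<beta>_def)
    have "a \<ge> 2" using True T by (simp add: a_def le_divide_eq)
    moreover have "a \<ge> y - 1" using T by (simp add: a_def y_def divide_right_mono mult_left_mono)
    ultimately have a: "y / 2 \<le> a" by linarith
    have "real s * real w / T \<le> real s * (real u - \<beta> * real (Suc u)) / T"
      using drop[OF True] T by (intro divide_right_mono mult_left_mono) (auto simp: \<beta>_def)
    also have "\<dots> = real s * real u / T - \<beta> * a"
      using T by (simp add: a_def field_simps)
    finally have "1 + real s * real w / T \<le> y - \<beta> * a" by (simp add: y_def)
    also have "\<dots> \<le> y - \<beta> * (y / 2)" using mult_left_mono[OF a \<open>\<beta> \<ge> 0\<close>] by simp
    also have "\<dots> = y * (1 + - (\<beta> / 2))" by (simp add: algebra_simps)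
    also have "\<dots> \<le> y * exp (- (\<beta> / 2))" using y1 by (intro mult_left_mono exp_ge_add_one_self) auto
    finally have "(1 + real s * real w / T) ^ Suc s \<le> (y * exp (- (\<beta> / 2))) ^ Suc s"
      using T by (intro power_mono) auto
    also have "\<dots> = y\<^sup>2 * exp (real (Suc s) * (- (\<beta> / 2))) * y ^ (s - 1)"
      unfolding power_mult_distrib split exp_of_nat_mult by (simp add: mult_ac)
    also have "\<dots> \<le> 1 * y ^ (s - 1)"
    proof (intro mult_right_mono)
      have "real s * \<beta> / 2 = real s ^ 3 / (4 * T)"
        by (simp add: \<beta>_def power2_eq_square power3_eq_cube)
      then have "real s ^ 3 / (4 * T) \<le> real (Suc s) * (\<beta> / 2)"
        using \<open>\<beta> \<ge> 0\<close> by (simp add: algebra_simps)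
      then have "exp (real (Suc s) * (- (\<beta> / 2))) \<le> exp (- (real s ^ 3 / (4 * T)))" by simp
      moreover have "real s * real u / T \<le> real s"
        using mult_left_mono[OF u, of "real s"] T by (simp add: divide_simps)
      then have "y\<^sup>2 \<le> (1 + real s)\<^sup>2" using y1 by (intro power_mono) (auto simp: y_def)
      then have "y\<^sup>2 \<le> exp (real s ^ 3 / (4 * T))" using s(2) by linarith
      ultimately have "y\<^sup>2 * exp (real (Suc s) * (- (\<beta> / 2)))
          \<le> exp (real s ^ 3 / (4 * T)) * exp (- (real s ^ 3 / (4 * T)))"
        by (intro mult_mono) auto
      then show "y\<^sup>2 * exp (real (Suc s) * (- (\<beta> / 2))) \<le> 1"
        by (simp add: exp_minus)
    qed (use y1 in auto)
    also have "\<dots> \<le> 9 * y ^ (s - 1)" using y1 by simp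
    finally show ?thesis by (simp add: y_def)
  qed
qed

text \<open>The recursion inequality for the potential, where \<open>u + 1\<close> candidates become \<open>u\<close> when \<open>v\<close> is discarded
and \<open>w\<close> when \<open>v\<close> is chosen. The convexity estimate \<open>power_Suc_add_ge\<close> bounds the growth of the
potential from \<open>u\<close> to \<open>u + 1\<close> from below. The constant \<open>324 = 4 * 9 * 9\<close> collects three losses:
\<open>(s + 1)\<^sup>2 \<le> 4 * s\<^sup>2\<close>, the factor 9 from replacing the slope \<open>s + 1\<close> by \<open>s\<close> in a power \<open>s + 1\<close>, and the
factor 9 of the preceding lemma.\<close>

lemma potential_step:
  assumes T: "T > 0" and s: "s \<ge> 1" "(1 + real s)\<^sup>2 \<le> exp (real s ^ 3 / (4 * T))"
    and u: "real u \<le> T" and w: "w \<le> u"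
    and drop: "real s * real (Suc u) \<ge> 2 * T
      \<Longrightarrow> real w \<le> real u - (real s)\<^sup>2 / (2 * T) * real (Suc u)"
  shows "potential T s u + potential T (Suc s) w \<le> potential T s (Suc u)"
proof -
  define B where "B = exp (2 * sqrt (324 * T)) * (fact s)\<^sup>2 / (324 * T) ^ s"
  define y where "y = 1 + real s * real u / T"
  define h where "h = real s / T"
  define z where "z = (1 + real (Suc s) * real w / T) ^ Suc s"
  have B: "B > 0" using T by (simp add: B_def)
  have y1: "y \<ge> 1" and h: "h > 0" using T s by (simp_all add: y_def h_def)
  have core: "(1 + real s * real w / T) ^ Suc s \<le> 9 * (1 + real s * real u / T) ^ (s - 1)"
    by (rule power_candidates_le[OF T s u w]) (rule drop)
  have "1 + real (Suc s) * real w / T \<le> (1 + 1 / real s) * (1 + real s * real w / T)"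
    using T s(1) by (simp add: field_simps)
  then have "z \<le> ((1 + 1 / real s) * (1 + real s * real w / T)) ^ Suc s"
    unfolding z_def using T by (intro power_mono) auto
  also have "\<dots> \<le> 9 * (9 * y ^ (s - 1))"
    unfolding power_mult_distrib y_def
    using T by (intro mult_mono one_plus_inverse_power_le s(1) core) auto
  finally have z: "z \<le> 81 * y ^ (s - 1)" by simp
  have "potential T (Suc s) w = B * ((real (Suc s))\<^sup>2 / (324 * T)) * z"
    by (simp add: potential_def B_def z_def power_mult_distrib mult_ac)
  also have "\<dots> \<le> B * ((2 * real s)\<^sup>2 / (324 * T)) * (81 * y ^ (s - 1))"
    using B T s z by (intro mult_mono divide_right_mono power_mono) (auto simp: z_def)
  also have "\<dots> = B * (real s * h * y ^ (s - 1))"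
    using T by (simp add: h_def power2_eq_square field_simps)
  finally have "potential T s u + potential T (Suc s) w
      \<le> B * (y ^ s + real s * h * y ^ (s - 1))"
    by (simp add: potential_def B_def y_def distrib_left)
  also have "\<dots> \<le> B * (y + h) ^ s"
    using power_Suc_add_ge[of y h "s - 1"] y1 h s(1) B by (intro mult_left_mono) auto
  also have "y + h = 1 + real s * real (Suc u) / T"
    by (simp add: y_def h_def field_simps add_divide_distrib)
  finally show ?thesis by (simp add: potential_def B_def)
qed

text \<open>From \<open>s \<ge> T powr (2/5)\<close>, that is \<open>T \<le> s powr (5/2)\<close>, it follows that \<open>s ^ 3 / (4 * T) \<ge> sqrt s / 4\<close>, so
the exponential beats the square. Any exponent strictly between 1/3 and 1/2 would serve as \<open>2/5\<close>
does: above 1/3 for the exponential to win here, below 1/2 for the cost of the initial choices to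
stay below \<open>exp (sqrt T)\<close>.\<close>

lemma eventually_starting_size:
  "\<forall>\<^sub>F T :: real in at_top. \<forall>s \<ge> nat \<lceil>T powr (2/5)\<rceil>.
     s \<ge> 1 \<and> (1 + real s)\<^sup>2 \<le> exp (real s ^ 3 / (4 * T))"
proof -
  have "\<forall>\<^sub>F x :: real in at_top. (1 + x)\<^sup>2 \<le> exp (sqrt x / 4)" by real_asymp
  then obtain X where X: "\<And>x. x \<ge> X \<Longrightarrow> (1 + x)\<^sup>2 \<le> exp (sqrt x / 4)"
    by (auto simp: eventually_at_top_linorder)
  have "\<forall>\<^sub>F T :: real in at_top. T powr (2/5) \<ge> X"
  proof -
    have "filterlim (\<lambda>T::real. T powr (2/5)) at_top at_top" by real_asymp
    then show ?thesis by (simp add: filterlim_at_top)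
  qed
  then show ?thesis using eventually_gt_at_top[of 0]
  proof eventually_elim
    case (elim T)
    show ?case
    proof (intro allI impI)
      fix s assume "s \<ge> nat \<lceil>T powr (2/5)\<rceil>"
      then have s: "T powr (2/5) \<le> real s" by linarith
      then have spos: "real s > 0" using elim by (smt (verit) powr_gt_zero)
      have "T = (T powr (2/5)) powr (5/2)" using elim by (simp add: powr_powr)
      also have "\<dots> \<le> real s powr (5/2)" using s by (intro powr_mono2) auto
      finally have "sqrt (real s) * T \<le> sqrt (real s) * real s powr (5/2)"
        by (intro mult_left_mono) auto
      also have "\<dots> = real s powr (1/2) * real s powr (5/2)" using spos by (simp add: powr_half_sqrt)
      also have "\<dots> = real s ^ 3" using spos by (simp add: powr_add[symmetric])
      finally have "sqrt (real s) / 4 \<le> real s ^ 3 / (4 * T)"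
        using elim by (simp add: field_simps)
      then have "exp (sqrt (real s) / 4) \<le> exp (real s ^ 3 / (4 * T))" by simp
      moreover have "(1 + real s)\<^sup>2 \<le> exp (sqrt (real s) / 4)" using s elim by (intro X) linarith
      ultimately show "s \<ge> 1 \<and> (1 + real s)\<^sup>2 \<le> exp (real s ^ 3 / (4 * T))"
        using spos by linarith
    qed
  qed
qed

text \<open>At \<open>s = \<lceil>T powr (2/5)\<rceil>\<close> the potential is at most \<open>exp (36 * sqrt T) * (1 + s) ^ s\<close>, because
\<open>(fact s)\<^sup>2 \<le> (s\<^sup>2) ^ s \<le> (324 * T) ^ s\<close>. All the remaining factors amount to
\<open>exp (O(T powr (2/5) * ln T))\<close>, which one further \<open>sqrt T\<close> in the exponent absorbs.\<close>

lemma eventually_total_bound: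
  "\<forall>\<^sub>F T :: real in at_top. \<forall>u. real u \<le> T \<longrightarrow>
     (T + 1) ^ nat \<lceil>T powr (2/5)\<rceil> * (1 + potential T (nat \<lceil>T powr (2/5)\<rceil>) u) \<le> exp (37 * sqrt T)"
proof -
  have "\<forall>\<^sub>F T :: real in at_top. ln 2 + (T powr (2/5) + 1) * (ln (T + 1) + ln (T powr (2/5) + 2)) \<le> sqrt T"
    by real_asymp
  moreover have "\<forall>\<^sub>F T :: real in at_top. (T powr (2/5) + 1)\<^sup>2 \<le> 324 * T" by real_asymp
  ultimately show ?thesis using eventually_gt_at_top[of 0]
  proof eventually_elim
    case (elim T)
    define s where "s = nat \<lceil>T powr (2/5)\<rceil>"
    define E where "E = exp (36 * sqrt T)"
    have s: "real s \<le> T powr (2/5) + 1"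
      unfolding s_def using powr_ge_zero[of T "2/5"] by linarith
    show ?case unfolding s_def[symmetric]
    proof (intro allI impI)
      fix u assume u: "real u \<le> T"
      have "(fact s :: real) \<le> real s ^ s" using fact_le_power[of s, where 'a = real] by simp
      then have "(fact s :: real)\<^sup>2 \<le> (real s ^ s)\<^sup>2" by (intro power_mono) auto
      also have "\<dots> = ((real s)\<^sup>2) ^ s" by (simp add: power_mult[symmetric] mult.commute)
      also have "\<dots> \<le> (324 * T) ^ s"
      proof (rule power_mono)
        have "(real s)\<^sup>2 \<le> (T powr (2/5) + 1)\<^sup>2" by (rule power_mono[OF s]) simp
        then show "(real s)\<^sup>2 \<le> 324 * T" using elim(2) by linarith
      qed simp
      finally have f: "(fact s)\<^sup>2 / (324 * T) ^ s \<le> 1" using elim(3) by simp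
      have "real s * real u / T \<le> real s"
        using mult_left_mono[OF u, of "real s"] elim(3) by (simp add: divide_simps)
      then have p: "(1 + real s * real u / T) ^ s \<le> (1 + real s) ^ s"
        using elim(3) by (intro power_mono) auto
      have "sqrt (324 * T) = 18 * sqrt T"
        using real_sqrt_mult[of 324 T] real_sqrt_unique[of 18 324] by simp
      then have "potential T s u = E * ((fact s)\<^sup>2 / (324 * T) ^ s) * (1 + real s * real u / T) ^ s"
        by (simp add: potential_def E_def)
      also have "\<dots> \<le> E * 1 * (1 + real s) ^ s"
        using f p elim(3) by (intro mult_mono) (auto simp: E_def)
      finally have pot: "potential T s u \<le> E * (1 + real s) ^ s" by simp
      have "1 \<le> E" using elim(3) by (simp add: E_def)
      moreover have "1 \<le> (1 + real s) ^ s" by (intro one_le_power) auto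
      ultimately have "1 \<le> E * (1 + real s) ^ s" by (metis mult_mono' mult_1 zero_le_one)
      with pot have "(T + 1) ^ s * (1 + potential T s u) \<le> (T + 1) ^ s * (2 * (E * (1 + real s) ^ s))"
        using elim(3) by (intro mult_left_mono) auto
      also have "\<dots> = 2 * E * exp (real s * (ln (T + 1) + ln (1 + real s)))"
        using elim(3) by (simp add: exp_of_nat_mult exp_add power_mult_distrib)
      also have "\<dots> = exp (ln 2 + 36 * sqrt T + real s * (ln (T + 1) + ln (1 + real s)))"
        by (simp add: E_def exp_add)
      also have "\<dots> \<le> exp (37 * sqrt T)"
      proof -
        have "real s * (ln (T + 1) + ln (1 + real s))
            \<le> (T powr (2/5) + 1) * (ln (T + 1) + ln (T powr (2/5) + 2))"
          using s elim(3) by (intro mult_mono add_mono) auto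
        then show ?thesis using elim(1) by simp
      qed
      finally show "(T + 1) ^ s * (1 + potential T s u) \<le> exp (37 * sqrt T)" .
    qed
  qed
qed

section \<open>Counting Sidon subsets of a set with small sumset\<close>

definition extensions :: "'a::plus set \<Rightarrow> 'a set \<Rightarrow> 'a set set" where
  "extensions S U = {W. W \<subseteq> U \<and> sidon (S \<union> W)}"

lemma finite_extensions: "finite U \<Longrightarrow> finite (extensions S U)"
  by (rule finite_subset[of _ "Pow U"]) (auto simp: extensions_def)

lemma extensions_branch:
  fixes S U :: "'a::ab_group_add set"
  assumes "v \<in> U" "S \<inter> U = {}"
  shows "extensions S U \<subseteq> extensions S (U - {v}) \<union>
    insert v ` extensions (insert v S) (U - {v} - conflicts S v)"
proof
  fix W assume "W \<in> extensions S U"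
  then have W: "W \<subseteq> U" "sidon (S \<union> W)" by (auto simp: extensions_def)
  show "W \<in> extensions S (U - {v}) \<union>
    insert v ` extensions (insert v S) (U - {v} - conflicts S v)"
  proof (cases "v \<in> W")
    case False
    then show ?thesis using W by (auto simp: extensions_def)
  next
    case True
    have "y \<notin> conflicts S v" if "y \<in> W" for y
      using sidon_excludes_conflicts[OF W(2), of S v y] True that W assms by blast
    moreover have "insert v S \<union> (W - {v}) = S \<union> W" using True by auto
    ultimately have "W - {v} \<in> extensions (insert v S) (U - {v} - conflicts S v)"
      using W by (auto simp: extensions_def)
    moreover have "W = insert v (W - {v})" using True by auto
    ultimately show ?thesis by blast
  qed
qed

text \<open>Induction on the number of candidates, branching on a candidate \<open>v\<close> with many conflicts. If \<open>S\<close>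
is not a Sidon set there is nothing to count, so the element \<open>v\<close> of \<open>many_conflicts\<close> is sought only
for Sidon sets \<open>S\<close>.\<close>

lemma card_extensions_le:
  fixes V :: "'a::ab_group_add set"
  assumes V: "finite V" "real (card V) \<le> T"
    and sums: "real (card ((\<lambda>p. fst p + snd p) ` (V \<times> V))) \<le> T"
    and T: "T > 0"
    and threshold: "\<And>s. s \<ge> k \<Longrightarrow> s \<ge> 1 \<and> (1 + real s)\<^sup>2 \<le> exp (real s ^ 3 / (4 * T))"
  shows "S \<subseteq> V \<Longrightarrow> U \<subseteq> V \<Longrightarrow> S \<inter> U = {} \<Longrightarrow> card S \<ge> k
    \<Longrightarrow> real (card (extensions S U)) \<le> potential T (card S) (card U)"
proof (induction "card U" arbitrary: S U rule: less_induct)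
  case less
  have fin: "finite S" "finite U" using less.prems V(1) by (auto intro: finite_subset)
  consider "\<not> sidon S" | "U = {}" | "sidon S" "U \<noteq> {}" by blast
  then show ?case
  proof cases
    case 1
    then have "extensions S U = {}" by (auto simp: extensions_def dest: sidon_subset)
    then show ?thesis using potential_ge_1[OF T, of "card S" "card U"] by simp
  next
    case 2
    then have "extensions S U \<subseteq> {{}}" by (auto simp: extensions_def)
    then have "card (extensions S U) \<le> 1" using card_mono[of "{{}}" "extensions S U"] by simp
    then show ?thesis using potential_ge_1[OF T, of "card S" "card U"] by linarith
  next
    case 3
    define s where "s = card S"
    have s: "s \<ge> 1" "(1 + real s)\<^sup>2 \<le> exp (real s ^ 3 / (4 * T))"
      using threshold[of s] less.prems by (auto simp: s_def)
    have "real (card ((\<lambda>p. fst p + snd p) ` (U \<times> S))) \<le> T"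
    proof -
      have "card ((\<lambda>p. fst p + snd p) ` (U \<times> S)) \<le> card ((\<lambda>p. fst p + snd p) ` (V \<times> V))"
        using V less.prems by (intro card_mono image_mono) auto
      then show ?thesis using sums by linarith
    qed
    then obtain v where v: "v \<in> U"
      and deg: "real s * real (card U) \<ge> 2 * T
        \<Longrightarrow> real (card (U \<inter> conflicts S v)) \<ge> (real s)\<^sup>2 / (2 * T) * real (card U)"
      unfolding s_def using many_conflicts[OF fin(2,1) 3(1) T] 3(2) by blast
    define U1 where "U1 = U - {v}"
    define U2 where "U2 = U1 - conflicts S v"
    have sub: "U1 \<subseteq> U" "U2 \<subseteq> U1" "v \<notin> U2" by (auto simp: U1_def U2_def)
    have finU: "finite U1" "finite U2" using fin sub by (meson finite_subset)+
    have cU: "card U = Suc (card U1)"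
      unfolding U1_def by (rule card_Suc_Diff1[OF fin(2) v, symmetric])
    have cU2: "card U2 \<le> card U1" by (rule card_mono[OF finU(1) sub(2)])
    have "U1 \<inter> conflicts S v = U \<inter> conflicts S v" by (auto simp: U1_def conflicts_def)
    then have "card U1 = card U2 + card (U \<inter> conflicts S v)"
      unfolding U2_def using card_Int_Diff[OF finU(1), of "conflicts S v"] by simp
    then have drop: "real (card U2) \<le> real (card U1) - (real s)\<^sup>2 / (2 * T) * real (Suc (card U1))"
      if "real s * real (Suc (card U1)) \<ge> 2 * T"
      using deg that unfolding cU by simp
    have vS: "v \<notin> S" using v less.prems by auto
    have IH1: "real (card (extensions S U1)) \<le> potential T s (card U1)"
      unfolding s_def
    proof (rule less.hyps)
      show "card U1 < card U" by (simp add: cU)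
    qed (use less.prems sub in blast)+
    have "real (card (extensions (insert v S) U2)) \<le> potential T (card (insert v S)) (card U2)"
    proof (rule less.hyps)
      show "card U2 < card U" using cU cU2 by simp
      show "k \<le> card (insert v S)" using less.prems(4) vS fin by simp
    qed (use less.prems sub v in blast)+
    then have IH2: "real (card (extensions (insert v S) U2)) \<le> potential T (Suc s) (card U2)"
      using vS fin by (simp add: s_def)
    have "card (extensions S U)
        \<le> card (extensions S U1 \<union> insert v ` extensions (insert v S) U2)"
      unfolding U1_def U2_def using fin less.prems v
      by (intro card_mono extensions_branch finite_UnI finite_imageI finite_extensions) auto
    also have "\<dots> \<le> card (extensions S U1) + card (insert v ` extensions (insert v S) U2)"
      by (rule card_Un_le)
    also have "\<dots> \<le> card (extensions S U1) + card (extensions (insert v S) U2)"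
      using finU by (simp add: card_image_le finite_extensions)
    finally have "real (card (extensions S U)) \<le> potential T s (card U1) + potential T (Suc s) (card U2)"
      using IH1 IH2 by linarith
    also have "\<dots> \<le> potential T s (Suc (card U1))"
    proof (rule potential_step[OF T s _ cU2])
      have "card U1 \<le> card V" using V less.prems by (intro card_mono) (auto simp: U1_def)
      then show "real (card U1) \<le> T" using V by linarith
    qed (rule drop)
    finally show ?thesis by (simp add: s_def cU)
  qed
qed

text \<open>A subset with at most \<open>k\<close> elements is obtained by \<open>k\<close> times adding either nothing or one element.\<close>

lemma card_small_subsets_le:
  assumes "finite V"
  shows "card {S. S \<subseteq> V \<and> card S \<le> k} \<le> (card V + 1) ^ k"
proof (induction k)
  case 0
  have "{S. S \<subseteq> V \<and> card S \<le> 0} = {{}}"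
    using assms by (auto dest: finite_subset)
  then show ?case by simp
next
  case (Suc k)
  let ?P = "\<lambda>k. {S. S \<subseteq> V \<and> card S \<le> k}"
  have fin: "finite (?P k)" using assms by (auto intro: finite_subset[of _ "Pow V"])
  have "?P (Suc k) \<subseteq> (\<lambda>(X, S). X \<union> S) ` (insert {} ((\<lambda>v. {v}) ` V) \<times> ?P k)"
  proof
    fix S assume S: "S \<in> ?P (Suc k)"
    then have "finite S" using assms finite_subset by auto
    show "S \<in> (\<lambda>(X, S). X \<union> S) ` (insert {} ((\<lambda>v. {v}) ` V) \<times> ?P k)"
    proof (cases "S = {}")
      case True
      then show ?thesis by force
    next
      case False
      then obtain v where "v \<in> S" by blast
      then show ?thesis using S \<open>finite S\<close>
        by (intro image_eqI[of _ _ "({v}, S - {v})"]) auto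
    qed
  qed
  then have "card (?P (Suc k)) \<le> card (insert {} ((\<lambda>v. {v}) ` V) \<times> ?P k)"
    using assms fin by (intro surj_card_le) auto
  also have "\<dots> \<le> (card V + 1) * card (?P k)"
  proof -
    have "card (insert {} ((\<lambda>v. {v}) ` V)) \<le> Suc (card ((\<lambda>v. {v}) ` V))"
      using assms by (intro card_insert_le_m1) auto
    also have "\<dots> \<le> card V + 1" using card_image_le[OF assms, of "\<lambda>v. {v}"] by simp
    finally show ?thesis unfolding card_cartesian_product by (rule mult_le_mono1)
  qed
  also have "\<dots> \<le> (card V + 1) * (card V + 1) ^ k" using Suc by (rule mult_le_mono2)
  finally show ?case by simp
qed

text \<open>A Sidon set with more than \<open>k\<close> elements is counted as an extension of one of its subsets of size
exactly \<open>k\<close>, and a smaller one is counted on its own. Each of the at most \<open>(T + 1) ^ k\<close> sets \<open>S0\<close> with at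
most \<open>k\<close> elements thus accounts for itself and, when its size is \<open>k\<close>, for its extensions.\<close>

lemma card_sidon_subsets_le:
  fixes V :: "'a::ab_group_add set"
  assumes V: "finite V" "real (card V) \<le> T"
    and sums: "real (card ((\<lambda>p. fst p + snd p) ` (V \<times> V))) \<le> T"
    and T: "T > 0"
    and threshold: "\<And>s. s \<ge> k \<Longrightarrow> s \<ge> 1 \<and> (1 + real s)\<^sup>2 \<le> exp (real s ^ 3 / (4 * T))"
    and total: "\<And>u. real u \<le> T \<Longrightarrow> (T + 1) ^ k * (1 + potential T k u) \<le> B"
  shows "real (card {S. S \<subseteq> V \<and> sidon S}) \<le> B"
proof -
  define P where "P = {S. S \<subseteq> V \<and> card S \<le> k}"
  define F where
    "F S0 = insert S0 (if card S0 = k then (\<union>) S0 ` extensions S0 (V - S0) else {})" for S0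
  have finP: "finite P" unfolding P_def using V by (auto intro: finite_subset[of _ "Pow V"])
  have finF: "finite (F S0)" for S0 using V by (auto simp: F_def finite_extensions)
  have cover: "{S. S \<subseteq> V \<and> sidon S} \<subseteq> (\<Union>S0\<in>P. F S0)"
  proof
    fix S assume "S \<in> {S. S \<subseteq> V \<and> sidon S}"
    then have S: "S \<subseteq> V" "sidon S" by auto
    show "S \<in> (\<Union>S0\<in>P. F S0)"
    proof (cases "card S \<le> k")
      case True
      then show ?thesis using S by (auto simp: P_def F_def)
    next
      case False
      then obtain S0 where S0: "S0 \<subseteq> S" "card S0 = k"
        by (metis nat_le_linear obtain_subset_with_card_n)
      then have "S - S0 \<in> extensions S0 (V - S0)"
        using S by (auto simp: extensions_def Un_absorb1)
      then have "S \<in> (\<union>) S0 ` extensions S0 (V - S0)"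
        by (rule rev_image_eqI) (use S0 in blast)
      then have "S \<in> F S0" using S0(2) by (simp add: F_def)
      then show ?thesis using S0 S by (auto simp: P_def)
    qed
  qed
  define G where "G = 1 + potential T k (card V - k)"
  have G: "real (card (F S0)) \<le> G" if "S0 \<in> P" for S0
  proof (cases "card S0 = k")
    case True
    have S0: "S0 \<subseteq> V" "finite S0" using that V(1) by (auto simp: P_def intro: finite_subset)
    have "card (F S0) \<le> Suc (card ((\<union>) S0 ` extensions S0 (V - S0)))"
      using True V by (simp add: F_def card_insert_if finite_extensions)
    also have "\<dots> \<le> Suc (card (extensions S0 (V - S0)))"
      using V by (simp add: card_image_le finite_extensions)
    finally have "real (card (F S0)) \<le> 1 + real (card (extensions S0 (V - S0)))" by linarith
    also have "real (card (extensions S0 (V - S0))) \<le> potential T (card S0) (card (V - S0))"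
      by (rule card_extensions_le[OF V sums T threshold]) (use S0 True in auto)
    finally show ?thesis using S0 True by (simp add: G_def card_Diff_subset)
  next
    case False
    then have "card (F S0) = 1" by (simp add: F_def)
    then show ?thesis using potential_ge_1[OF T, of k "card V - k"] by (simp add: G_def)
  qed
  have "card {S. S \<subseteq> V \<and> sidon S} \<le> card (\<Union>S0\<in>P. F S0)"
    using finP finF by (intro card_mono cover) auto
  also have "\<dots> \<le> (\<Sum>S0\<in>P. card (F S0))" by (rule card_UN_le[OF finP])
  finally have "real (card {S. S \<subseteq> V \<and> sidon S}) \<le> (\<Sum>S0\<in>P. real (card (F S0)))"
    by (simp only: of_nat_sum[symmetric] of_nat_le_iff)
  also have "\<dots> \<le> real (card P) * G" using G by (intro sum_bounded_above) auto
  also have "\<dots> \<le> (T + 1) ^ k * G"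
  proof (intro mult_right_mono)
    have "real (card P) \<le> real ((card V + 1) ^ k)"
      unfolding P_def of_nat_le_iff by (rule card_small_subsets_le[OF V(1)])
    also have "\<dots> \<le> (T + 1) ^ k" using V by (simp add: power_mono)
    finally show "real (card P) \<le> (T + 1) ^ k" .
    show "0 \<le> G" using potential_ge_1[OF T, of k "card V - k"] by (simp add: G_def)
  qed
  also have "\<dots> \<le> B" unfolding G_def using V by (intro total) linarith
  finally show ?thesis .
qed

lemma eventually_card_sidon_subsets_le:
  "\<forall>\<^sub>F T :: real in at_top. \<forall>V :: 'a::ab_group_add set.
     finite V \<longrightarrow> real (card ((\<lambda>p. fst p + snd p) ` (V \<times> V))) \<le> T \<longrightarrow>
     real (card {S. S \<subseteq> V \<and> sidon S}) \<le> exp (37 * sqrt T)"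
  using eventually_starting_size eventually_total_bound eventually_gt_at_top[of 0]
proof eventually_elim
  case (elim T)
  show ?case
  proof (intro allI impI)
    fix V :: "'a set"
    assume V: "finite V" and sums: "real (card ((\<lambda>p. fst p + snd p) ` (V \<times> V))) \<le> T"
    have "card V \<le> card ((\<lambda>p. fst p + snd p) ` (V \<times> V))"
    proof (cases "V = {}")
      case False
      then obtain v where v: "v \<in> V" by blast
      have "inj_on (\<lambda>x. v + x) V" by (rule inj_onI) simp
      moreover have "(\<lambda>x. v + x) ` V \<subseteq> (\<lambda>p. fst p + snd p) ` (V \<times> V)" using v by force
      ultimately show ?thesis using V by (intro card_inj_on_le) auto
    qed simp
    then have cV: "real (card V) \<le> T" using sums by linarith
    show "real (card {S. S \<subseteq> V \<and> sidon S}) \<le> exp (37 * sqrt T)"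
    proof (rule card_sidon_subsets_le[OF V cV sums elim(3)])
      show "s \<ge> 1 \<and> (1 + real s)\<^sup>2 \<le> exp (real s ^ 3 / (4 * T))"
        if "s \<ge> nat \<lceil>T powr (2/5)\<rceil>" for s
        by (rule elim(1)[rule_format, OF that])
      show "(T + 1) ^ nat \<lceil>T powr (2/5)\<rceil> * (1 + potential T (nat \<lceil>T powr (2/5)\<rceil>) u)
          \<le> exp (37 * sqrt T)" if "real u \<le> T" for u
        by (rule elim(2)[rule_format, OF that])
    qed
  qed
qed

section \<open>Sidon sets in the grid\<close>

text \<open>Vectors of different dimensions share one type, which is therefore not a group. Padding
the coordinates with zeros embeds each \<open>carrier_vec d\<close> additively into the group \<open>nat \<Rightarrow> int\<close>.\<close>

definition coords :: "int vec \<Rightarrow> nat \<Rightarrow> int" where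
  "coords a i = (if i < dim_vec a then a $ i else 0)"

lemma coords_add: "a \<in> carrier_vec d \<Longrightarrow> b \<in> carrier_vec d \<Longrightarrow> coords (a + b) = coords a + coords b"
  by (auto simp: coords_def fun_eq_iff)

lemma inj_on_coords: "inj_on coords (carrier_vec d)"
proof (rule inj_onI)
  fix a b assume ab: "a \<in> carrier_vec d" "b \<in> carrier_vec d" "coords a = coords b"
  show "a = b"
  proof (rule eq_vecI)
    fix i assume i: "i < dim_vec b"
    have "coords a i = coords b i" using ab(3) by simp
    then show "a $ i = b $ i" using ab(1,2) i by (auto simp: coords_def)
  qed (use ab in auto)
qed

lemma sidon_coords_image:
  assumes "S \<subseteq> carrier_vec d" "sidon S"
  shows "sidon (coords ` S)"
  unfolding sidon_def
proof (intro ballI impI)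
  fix a b c e
  assume "a \<in> coords ` S" "b \<in> coords ` S" "c \<in> coords ` S" "e \<in> coords ` S"
    and eq: "a + b = c + e"
  then obtain a' b' c' e' where
    m: "a' \<in> S" "b' \<in> S" "c' \<in> S" "e' \<in> S"
    and r: "a = coords a'" "b = coords b'" "c = coords c'" "e = coords e'" by blast
  have "coords (a' + b') = coords (c' + e')"
    using eq m assms unfolding r by (metis coords_add subsetD)
  then have "a' + b' = c' + e'"
    using m assms inj_onD[OF inj_on_coords[of d]] by (metis add_carrier_vec subsetD)
  then have "{a', b'} = {c', e'}" using assms(2) m unfolding sidon_def by blast
  then have "coords ` {a', b'} = coords ` {c', e'}" by (rule arg_cong)
  then show "{a, b} = {c, e}" unfolding r by (simp only: image_insert image_empty)
qed

lemma card_grid_le: "card (grid n d) \<le> n ^ d"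
proof -
  have "grid n d \<subseteq> vec_of_list ` {xs. set xs \<subseteq> {0..int n - 1} \<and> length xs = d}"
  proof
    fix a assume a: "a \<in> grid n d"
    have "a = vec_of_list (list_of_vec a)" by (simp add: vec_list)
    moreover have "set (list_of_vec a) \<subseteq> {0..int n - 1}" "length (list_of_vec a) = d"
      using a by (auto simp: grid_def in_set_conv_nth list_of_vec_index)
    ultimately show "a \<in> vec_of_list ` {xs. set xs \<subseteq> {0..int n - 1} \<and> length xs = d}"
      by blast
  qed
  then have "card (grid n d) \<le> card {xs. set xs \<subseteq> {0..int n - 1} \<and> length xs = d}"
    by (intro surj_card_le) (auto simp: finite_lists_length_eq)
  also have "\<dots> = n ^ d" by (simp add: card_lists_length_eq)
  finally show ?thesis .
qed

text \<open>A sum of two vectors of \<open>grid n d\<close> has entries at most \<open>2 * n - 2\<close>, hence lies in \<open>grid (2 * n) d\<close>.\<close>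

lemma card_grid_sums_le:
  "card ((\<lambda>p. fst p + snd p) ` (coords ` grid n d \<times> coords ` grid n d)) \<le> (2 * n) ^ d"
proof -
  have "(\<lambda>p. fst p + snd p) ` (coords ` grid n d \<times> coords ` grid n d) \<subseteq> coords ` grid (2 * n) d"
  proof clarsimp
    fix a b assume ab: "a \<in> grid n d" "b \<in> grid n d"
    then have c: "a \<in> carrier_vec d" "b \<in> carrier_vec d" by (auto simp: grid_def)
    have "a + b \<in> grid (2 * n) d"
      using ab by (fastforce simp: grid_def)
    then show "coords a + coords b \<in> coords ` grid (2 * n) d"
      using coords_add[OF c] by (metis imageI)
  qed
  then have "card ((\<lambda>p. fst p + snd p) ` (coords ` grid n d \<times> coords ` grid n d))
      \<le> card (grid (2 * n) d)"
    by (intro surj_card_le finite_grid)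
  also have "\<dots> \<le> (2 * n) ^ d" by (rule card_grid_le)
  finally show ?thesis .
qed

lemma sidon_count_le:
  "sidon_count n d \<le> card {S. S \<subseteq> coords ` grid n d \<and> sidon S}"
  unfolding sidon_count_def
proof (rule card_inj_on_le)
  have sub: "grid n d \<subseteq> carrier_vec d" by (auto simp: grid_def)
  show "inj_on ((`) coords) {S. S \<subseteq> grid n d \<and> sidon S}"
  proof (rule inj_on_subset)
    show "inj_on ((`) coords) (Pow (grid n d))"
      by (rule inj_on_image_Pow[OF inj_on_subset[OF inj_on_coords sub]])
  qed auto
  show "(`) coords ` {S. S \<subseteq> grid n d \<and> sidon S} \<subseteq> {S. S \<subseteq> coords ` grid n d \<and> sidon S}"
    using sidon_coords_image[of _ d] sub by auto
  show "finite {S. S \<subseteq> coords ` grid n d \<and> sidon S}"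
    by (rule finite_subset[of _ "Pow (coords ` grid n d)"]) (auto simp: finite_grid)
qed

theorem theorem1p2:
  fixes d :: nat
  assumes "d \<ge> 1"
  shows "\<exists>c::real. c > 0 \<and>
    (\<forall>\<^sub>F n in sequentially. real (sidon_count n d) \<le> 2 powr (c * real n powr (real d / 2)))"
proof -
  define c where "c = 37 * 2 powr (real d / 2) / ln 2"
  have "c > 0" by (simp add: c_def)
  have exp_as_powr: "exp y = 2 powr (y / ln 2)" for y :: real by (simp add: powr_def)
  have lim: "filterlim (\<lambda>n::nat. real ((2 * n) ^ d)) at_top sequentially"
  proof (rule filterlim_at_top_mono[OF filterlim_real_sequentially])
    have "n \<le> (2 * n) ^ d" if "n \<ge> 1" for n :: nat
      using self_le_power[of "2 * n" d] that assms by linarith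
    then show "\<forall>\<^sub>F n in sequentially. real n \<le> real ((2 * n) ^ d)"
      unfolding eventually_sequentially of_nat_le_iff by blast
  qed
  have "\<forall>\<^sub>F n in sequentially. \<forall>V :: (nat \<Rightarrow> int) set.
     finite V \<longrightarrow> real (card ((\<lambda>p. fst p + snd p) ` (V \<times> V))) \<le> real ((2 * n) ^ d) \<longrightarrow>
     real (card {S. S \<subseteq> V \<and> sidon S}) \<le> exp (37 * sqrt (real ((2 * n) ^ d)))"
    by (rule eventually_compose_filterlim[OF eventually_card_sidon_subsets_le lim])
  then have "\<forall>\<^sub>F n in sequentially. real (sidon_count n d) \<le> 2 powr (c * real n powr (real d / 2))"
    using eventually_gt_at_top[of 0]
  proof eventually_elim
    case (elim n)
    have "real (sidon_count n d) \<le> real (card {S. S \<subseteq> coords ` grid n d \<and> sidon S})"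
      using sidon_count_le by simp
    also have "\<dots> \<le> exp (37 * sqrt (real ((2 * n) ^ d)))"
    proof (rule elim(1)[rule_format])
      show "finite (coords ` grid n d)" by (simp add: finite_grid)
      show "real (card ((\<lambda>p. fst p + snd p) ` (coords ` grid n d \<times> coords ` grid n d)))
          \<le> real ((2 * n) ^ d)"
        by (simp only: of_nat_le_iff card_grid_sums_le)
    qed
    also have "sqrt (real ((2 * n) ^ d)) = ((2 * real n) powr real d) powr (1 / 2)"
      using elim(2) by (simp add: powr_half_sqrt powr_realpow)
    also have "\<dots> = (2 * real n) powr (real d / 2)" unfolding powr_powr by simp
    also have "\<dots> = 2 powr (real d / 2) * real n powr (real d / 2)" by (simp add: powr_mult)
    also have "exp (37 * (2 powr (real d / 2) * real n powr (real d / 2)))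
        = 2 powr (c * real n powr (real d / 2))"
      unfolding exp_as_powr c_def by (simp add: mult.assoc)
    finally show ?case .
  qed
  with \<open>c > 0\<close> show ?thesis by blast
qed

end
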